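(* Let $m$ and $n$ be positive integers, and let $X$ be a graph. Then (i) $T_2(X)=K_1\cup K_1$ if and only if $X=K_{1,1}$ or $X=K_{1,1}^c$; and (ii) if $m>1$ or $n>1$, then $T_2(X)=K_m\cup K_n$ if and only if $X$ is a spanning subgraph of $K_{m,n}$ such that $2\le \mathrm{diam}(X)\le 3$.
   Context: All graphs are finite and simple, but not necessarily connected; equality of graphs means graph isomorphism (and "$X$ is a spanning subgraph of $K_{m,n}$" is likewise understood up to isomorphism). $\mathrm{dist}_X(u,v)$ is the length of a shortest $u$-$v$ path in $X$, with $\mathrm{dist}_X(u,v)=\infty$ iff $u,v$ lie in different components; $\mathrm{diam}(X)=\max\{\mathrm{dist}_X(u,v):u,v\in V(X)\}$ (possibly $\infty$). The $2$-distance graph $T_2(X)$ is the graph with vertex set $V(X)$ in which $u,v$ are adjacent if and only if $\mathrm{dist}_X(u,v)=2$. $K_m$ is the complete graph of order $m$, $\cup$ denotes disjoint union, $K_{m,n}$ is the complete bipartite graph with parts of sizes $m$ and $n$, and $Y^c$ is the complement of a graph $Y$. A subgraph $Y$ of $Z$ is spanning if $V(Y)=V(Z)$. *)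

theory Defs
  imports "Graph_Theory.Graph_Theory"
begin

text \<open>A finite simple graph is a \<open>'a pair_pre_digraph\<close> satisfying \<open>pair_graph\<close>: finite, loopless
  and with a symmetric arc relation, so that an edge \<open>uv\<close> is the pair of arcs \<open>(u, v)\<close>, \<open>(v, u)\<close>.
  Equality of graphs is rendered as \<open>digraph_iso\<close>.\<close>

text \<open>The library's \<open>\<mu>\<close> is an infimum over walks; with unit weights it is the length of a shortest
  path, or \<open>\<infinity>\<close> if there is none (\<open>graph_dist_eq_shortest_path\<close> below).\<close>

definition graph_dist :: "'a pair_pre_digraph \<Rightarrow> 'a \<Rightarrow> 'a \<Rightarrow> ereal" where
  "graph_dist X u v = wf_digraph.\<mu> (with_proj X) (\<lambda>_. 1) u v"

definition graph_diam :: "'a pair_pre_digraph \<Rightarrow> ereal" where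
  "graph_diam X = Max {graph_dist X u v | u v. u \<in> pverts X \<and> v \<in> pverts X}"

definition two_distance_graph :: "'a pair_pre_digraph \<Rightarrow> 'a pair_pre_digraph" where
  "two_distance_graph X =
    \<lparr> pverts = pverts X,
      parcs = {(u, v). u \<in> pverts X \<and> v \<in> pverts X \<and> graph_dist X u v = 2} \<rparr>"

definition complement_graph :: "'a pair_pre_digraph \<Rightarrow> 'a pair_pre_digraph" where
  "complement_graph X =
    \<lparr> pverts = pverts X,
      parcs = {(u, v). u \<in> pverts X \<and> v \<in> pverts X \<and> u \<noteq> v \<and> (u, v) \<notin> parcs X} \<rparr>"

definition disjoint_union ::
    "'a pair_pre_digraph \<Rightarrow> 'b pair_pre_digraph \<Rightarrow> ('a + 'b) pair_pre_digraph" where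
  "disjoint_union X Y =
    \<lparr> pverts = pverts X <+> pverts Y,
      parcs = map_prod Inl Inl ` parcs X \<union> map_prod Inr Inr ` parcs Y \<rparr>"

text \<open>The library has \<open>K\<^sub>m\<close> and \<open>K\<^sub>m\<^sub>,\<^sub>n\<close> only as predicates; these are concrete
  representatives (see \<open>complete_digraph_complete_graph\<close> and
  \<open>complete_bipartite_digraph_complete_bipartite_graph\<close>).\<close>

definition complete_graph :: "nat \<Rightarrow> nat pair_pre_digraph" where
  "complete_graph m =
    \<lparr> pverts = {..<m}, parcs = {(i, j). i < m \<and> j < m \<and> i \<noteq> j} \<rparr>"

definition complete_bipartite_graph :: "nat \<Rightarrow> nat \<Rightarrow> (nat + nat) pair_pre_digraph" where
  "complete_bipartite_graph m n =
    \<lparr> pverts = {..<m} <+> {..<n},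
      parcs = (Inl ` {..<m}) \<times> (Inr ` {..<n}) \<union> (Inr ` {..<n}) \<times> (Inl ` {..<m}) \<rparr>"

lemma graph_dist_eq_shortest_path:
  assumes "pair_graph X"
  shows "graph_dist X u v =
    (INF p \<in> {p. pre_digraph.apath (with_proj X) u p v}. ereal (real (length p)))"
proof -
  interpret pair_graph X by (fact assms)
  have cost: "awalk_cost (\<lambda>_. 1) p = real (length p)" for p :: "('a \<times> 'a) list"
    by (induct p) auto
  have shorten: "\<exists>q. apath u q v \<and> length q \<le> length p" if "awalk u p v" for p
    using that
  proof (induct rule: awalk_to_apath_induct)
    case (path p)
    then show ?case by (auto simp: apath_def)
  next
    case (decomp p q r s)
    then have "length (q @ s) \<le> length p"
      by (auto elim!: awalk_cyc_decompE)
    then show ?case using decomp by (meson le_trans)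
  qed
  show ?thesis
    unfolding graph_dist_def \<mu>_def cost
  proof (rule antisym)
    show "(INF p\<in>{p. awalk u p v}. ereal (real (length p)))
        \<le> (INF p\<in>{p. apath u p v}. ereal (real (length p)))"
      by (rule INF_superset_mono) (auto simp: apath_def)
    show "(INF p\<in>{p. apath u p v}. ereal (real (length p)))
        \<le> (INF p\<in>{p. awalk u p v}. ereal (real (length p)))"
      using shorten by (intro INF_mono) auto
  qed
qed

lemma complete_digraph_complete_graph:
  "complete_digraph m (with_proj (complete_graph m))"
  unfolding complete_digraph_pair_def by (auto simp: complete_graph_def)

lemma complete_bipartite_digraph_complete_bipartite_graph:
  "complete_bipartite_digraph m n (with_proj (complete_bipartite_graph m n))"
  unfolding complete_bipartite_digraph_pair_def
proof (intro conjI exI)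
  let ?U = "(Inl :: nat \<Rightarrow> nat + nat) ` {..<m}" and ?V = "(Inr :: nat \<Rightarrow> nat + nat) ` {..<n}"
  show "finite (pverts (complete_bipartite_graph m n))"
    and "pverts (complete_bipartite_graph m n) = ?U \<union> ?V"
    and "?U \<inter> ?V = {}"
    and "card ?U = m" and "card ?V = n"
    and "parcs (complete_bipartite_graph m n) = ?U \<times> ?V \<union> ?V \<times> ?U"
    by (auto simp: complete_bipartite_graph_def card_image)
qed

end

theory Submission
  imports Defs
begin

text \<open>If \<open>T\<^sub>2(X)\<close> is a disjoint union of two complete graphs, then no edge of \<open>X\<close> joins two
  vertices of one of them, since these are at distance \<open>2\<close>; hence \<open>X\<close> is bipartite with these two
  parts. Conversely, in a bipartite graph of diameter at most \<open>3\<close> the parity of a distance tells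
  whether the two vertices lie in the same part, and the only positive even value left is \<open>2\<close>. So
  the same partition of the vertices serves both sides of the equivalence.

  The partition is carried by a bijection \<open>f\<close> from the vertices of \<open>X\<close> to \<open>{..<m} <+> {..<n}\<close>,
  with \<open>isl \<circ> f\<close> as a 2-coloring. An isomorphism between \<open>T\<^sub>2(X)\<close> and \<open>K\<^sub>m \<union> K\<^sub>n\<close> is such an \<open>f\<close>
  for which the distance of distinct vertices is \<open>2\<close> exactly when their colors agree
  (\<open>two_distance_graph_iso_disjoint_union_iff\<close>); an isomorphism onto a spanning subgraph of
  \<open>K\<^sub>m\<^sub>,\<^sub>n\<close> is such an \<open>f\<close> that is a proper coloring
  (\<open>iso_to_spanning_subgraph_complete_bipartite_iff\<close>). Given two vertices of one color, which exist
  when \<open>m > 1\<close> or \<open>n > 1\<close>, the first property holds precisely if the second does and the diameter is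
  \<open>2\<close> or \<open>3\<close> (\<open>dist_2_iff_same_color_iff_bipartite_diam\<close>). With only two vertices distance \<open>2\<close>
  is impossible, which leaves the edge and its complement.\<close>

section \<open>Isomorphism as a bijection of vertices\<close>

lemma digraph_iso_with_proj_iff:
  assumes "pair_wf_digraph G" and "pair_wf_digraph H"
  shows "digraph_iso (with_proj G) (with_proj H) \<longleftrightarrow>
    (\<exists>f. bij_betw f (pverts G) (pverts H) \<and>
      (\<forall>u\<in>pverts G. \<forall>v\<in>pverts G. (u, v) \<in> parcs G \<longleftrightarrow> (f u, f v) \<in> parcs H))"
    (is "?L \<longleftrightarrow> ?R")
proof -
  interpret G: pair_wf_digraph G by (fact assms(1))
  interpret H: pair_wf_digraph H by (fact assms(2))
  show ?thesis
  proof
    assume ?L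
    then obtain h where h: "G.digraph_isomorphism h" and H: "with_proj H = app_iso h (with_proj G)"
      unfolding digraph_iso_def by blast
    let ?f = "iso_verts h"
    have V: "pverts H = ?f ` pverts G" and E: "parcs H = iso_arcs h ` parcs G"
      and t: "iso_tail h = fst" and hd: "iso_head h = snd"
      using arg_cong[OF H, of verts] arg_cong[OF H, of arcs] arg_cong[OF H, of tail]
        arg_cong[OF H, of head] by auto
    have inj: "inj_on ?f (pverts G)"
      using h by (simp add: G.digraph_isomorphism_def)
    have "iso_arcs h e = (?f (fst e), ?f (snd e))" if "e \<in> parcs G" for e
      using h that t hd by (simp add: G.digraph_isomorphism_def prod_eq_iff)
    then have E': "parcs H = (\<lambda>e. (?f (fst e), ?f (snd e))) ` parcs G"
      unfolding E by (intro image_cong) auto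
    have "(u, v) \<in> parcs G \<longleftrightarrow> (?f u, ?f v) \<in> parcs H"
      if "u \<in> pverts G" "v \<in> pverts G" for u v
    proof
      assume "(u, v) \<in> parcs G"
      then show "(?f u, ?f v) \<in> parcs H"
        unfolding E' by (rule rev_image_eqI) simp
    next
      assume "(?f u, ?f v) \<in> parcs H"
      then obtain e where e: "e \<in> parcs G" "?f u = ?f (fst e)" "?f v = ?f (snd e)"
        unfolding E' by auto
      then have "u = fst e" "v = snd e"
        using that inj G.arc_fst_in_verts G.arc_snd_in_verts by (auto dest: inj_onD)
      with e show "(u, v) \<in> parcs G" by simp
    qed
    with V inj show ?R
      by (intro exI[of _ ?f]) (auto simp: bij_betw_def)
  next
    assume ?R
    then obtain f where f: "bij_betw f (pverts G) (pverts H)"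
      and E: "\<And>u v. u \<in> pverts G \<Longrightarrow> v \<in> pverts G \<Longrightarrow>
        (u, v) \<in> parcs G \<longleftrightarrow> (f u, f v) \<in> parcs H"
      by blast
    let ?h = "\<lparr>iso_verts = f, iso_arcs = map_prod f f, iso_head = snd, iso_tail = fst\<rparr>"
    have inj: "inj_on f (pverts G)" and V: "f ` pverts G = pverts H"
      using f by (auto simp: bij_betw_def)
    have "parcs G \<subseteq> pverts G \<times> pverts G"
      using G.in_arcsD1 G.in_arcsD2 by auto
    then have "inj_on (map_prod f f) (parcs G)"
      using map_prod_inj_on[OF inj inj] by (rule inj_on_subset[rotated])
    then have "G.digraph_isomorphism ?h"
      using inj G.wf_digraph_axioms by (auto simp: G.digraph_isomorphism_def)
    moreover have "map_prod f f ` parcs G = parcs H"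
    proof (intro equalityI subrelI)
      fix x y assume "(x, y) \<in> map_prod f f ` parcs G"
      then obtain u v where "(u, v) \<in> parcs G" "x = f u" "y = f v"
        by auto
      then show "(x, y) \<in> parcs H"
        using E G.in_arcsD1 G.in_arcsD2 by blast
    next
      fix x y assume xy: "(x, y) \<in> parcs H"
      then obtain u v where "u \<in> pverts G" "v \<in> pverts G" "x = f u" "y = f v"
        using V H.in_arcsD1 H.in_arcsD2 by blast
      with E xy show "(x, y) \<in> map_prod f f ` parcs G"
        by (intro rev_image_eqI[of "(u, v)"]) auto
    qed
    then have "with_proj H = app_iso ?h (with_proj G)"
      using V by (simp add: app_iso_def with_proj_def)
    ultimately show ?L
      unfolding digraph_iso_def by blast
  qed
qed

text \<open>The spanning subgraph in question is the image of \<open>X\<close>, so being isomorphic to one only asks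
  for a vertex bijection that sends arcs to arcs.\<close>

lemma iso_to_spanning_subgraph_iff:
  assumes "pair_wf_digraph X" and "pair_wf_digraph K"
  shows "(\<exists>Y. spanning (with_proj Y) (with_proj K) \<and> digraph_iso (with_proj X) (with_proj Y)) \<longleftrightarrow>
    (\<exists>f. bij_betw f (pverts X) (pverts K) \<and> (\<forall>(u, v)\<in>parcs X. (f u, f v) \<in> parcs K))"
    (is "?L \<longleftrightarrow> ?R")
proof
  assume ?L
  then obtain Y where Y: "spanning (with_proj Y) (with_proj K)"
    and iso: "digraph_iso (with_proj X) (with_proj Y)"
    by blast
  from Y have wfY: "pair_wf_digraph Y" and V: "pverts Y = pverts K" and E: "parcs Y \<subseteq> parcs K"
    by (auto simp: spanning_def subgraph_def wf_digraph_wp_iff)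
  from iso obtain f where "bij_betw f (pverts X) (pverts Y)"
    and "\<forall>u\<in>pverts X. \<forall>v\<in>pverts X. (u, v) \<in> parcs X \<longleftrightarrow> (f u, f v) \<in> parcs Y"
    using digraph_iso_with_proj_iff[OF assms(1) wfY] by blast
  moreover from this have "(f u, f v) \<in> parcs K" if "(u, v) \<in> parcs X" for u v
    using that E pair_wf_digraph.in_arcsD1[OF assms(1) that]
      pair_wf_digraph.in_arcsD2[OF assms(1) that] by blast
  ultimately show ?R
    unfolding V by (intro exI[of _ f]) auto
next
  assume ?R
  then obtain f where f: "bij_betw f (pverts X) (pverts K)"
    and E: "\<And>u v. (u, v) \<in> parcs X \<Longrightarrow> (f u, f v) \<in> parcs K"
    by auto
  let ?Y = "\<lparr>pverts = pverts K, parcs = map_prod f f ` parcs X\<rparr>"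
  interpret X: pair_wf_digraph X by (fact assms(1))
  interpret K: pair_wf_digraph K by (fact assms(2))
  have inj: "inj_on f (pverts X)"
    using f by (simp add: bij_betw_def)
  have sub: "map_prod f f ` parcs X \<subseteq> parcs K"
    using E by auto
  then have wfY: "pair_wf_digraph ?Y"
    by unfold_locales
      (simp_all only: pair_pre_digraph.simps, (metis K.arc_fst_in_verts K.arc_snd_in_verts subsetD)+)
  have "(u, v) \<in> parcs X \<longleftrightarrow> (f u, f v) \<in> parcs ?Y"
    if "u \<in> pverts X" "v \<in> pverts X" for u v
  proof
    assume "(u, v) \<in> parcs X"
    then show "(f u, f v) \<in> parcs ?Y" by force
  next
    assume "(f u, f v) \<in> parcs ?Y"
    then obtain x y where xy: "(x, y) \<in> parcs X" "f x = f u" "f y = f v" by auto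
    then have "x = u" "y = v"
      using that inj X.in_arcsD1[OF xy(1)] X.in_arcsD2[OF xy(1)] by (auto dest: inj_onD)
    with xy show "(u, v) \<in> parcs X" by simp
  qed
  then have "digraph_iso (with_proj X) (with_proj ?Y)"
    using digraph_iso_with_proj_iff[OF assms(1) wfY] f by auto
  moreover have "spanning (with_proj ?Y) (with_proj K)"
    using sub wfY assms(2)
    by (auto simp: spanning_def subgraph_def wf_digraph_wp_iff compatible_def)
  ultimately show ?L by blast
qed

section \<open>Short distances\<close>

context pair_wf_digraph
begin

text \<open>The infimum that defines the distance is attained: it ranges over natural numbers. So a
  strict bound \<open>k\<close> is witnessed by a walk with fewer than \<open>k\<close> arcs, and the weak bound \<open>k\<close>
  amounts to the strict bound \<open>k + 1\<close>.\<close>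

lemma graph_dist_less_iff:
  "graph_dist G u v < ereal (real k) \<longleftrightarrow> (\<exists>p. awalk u p v \<and> length p < k)"
  and graph_dist_le_iff:
  "graph_dist G u v \<le> ereal (real k) \<longleftrightarrow> (\<exists>p. awalk u p v \<and> length p \<le> k)"
proof -
  have cost: "awalk_cost (\<lambda>_. 1) p = real (length p)" for p :: "('a \<times> 'a) list"
    by (induct p) auto
  have dist: "graph_dist G u v = (INF p\<in>{p. awalk u p v}. ereal (real (length p)))"
    unfolding graph_dist_def \<mu>_def cost ..
  show less: "graph_dist G u v < ereal (real k) \<longleftrightarrow> (\<exists>p. awalk u p v \<and> length p < k)" for k
    unfolding dist by (simp add: INF_less_iff)
  show "graph_dist G u v \<le> ereal (real k) \<longleftrightarrow> (\<exists>p. awalk u p v \<and> length p \<le> k)"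
  proof
    assume "graph_dist G u v \<le> ereal (real k)"
    also have "\<dots> < ereal (real (Suc k))" by simp
    finally show "\<exists>p. awalk u p v \<and> length p \<le> k"
      using less[of "Suc k"] by (auto simp: less_Suc_eq_le)
  next
    assume "\<exists>p. awalk u p v \<and> length p \<le> k"
    then show "graph_dist G u v \<le> ereal (real k)"
      unfolding dist by (auto intro: INF_lower2)
  qed
qed

lemma graph_dist_eq_2_iff:
  assumes "u \<in> pverts G"
  shows "graph_dist G u v = 2 \<longleftrightarrow>
    u \<noteq> v \<and> (u, v) \<notin> parcs G \<and> (\<exists>w. (u, w) \<in> parcs G \<and> (w, v) \<in> parcs G)"
proof -
  have "graph_dist G u v = 2 \<longleftrightarrow> graph_dist G u v \<le> 2 \<and> \<not> graph_dist G u v < 2"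
    by auto
  also have "\<dots> \<longleftrightarrow> (\<exists>p. awalk u p v \<and> length p \<le> 2) \<and> \<not> (\<exists>p. awalk u p v \<and> length p < 2)"
    using graph_dist_le_iff[of u v 2] graph_dist_less_iff[of u v 2] by simp
  also have "\<dots> \<longleftrightarrow> (\<exists>p. awalk u p v \<and> length p = 2) \<and> \<not> (\<exists>p. awalk u p v \<and> length p < 2)"
    by (auto simp: le_less)
  also have "(\<exists>p. awalk u p v \<and> length p = 2) \<longleftrightarrow> (\<exists>w. (u, w) \<in> parcs G \<and> (w, v) \<in> parcs G)"
  proof
    assume "\<exists>p. awalk u p v \<and> length p = 2"
    then show "\<exists>w. (u, w) \<in> parcs G \<and> (w, v) \<in> parcs G"
      by (auto simp: numeral_2_eq_2 length_Suc_conv awalk_simps)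
  next
    assume "\<exists>w. (u, w) \<in> parcs G \<and> (w, v) \<in> parcs G"
    then obtain w where "(u, w) \<in> parcs G" "(w, v) \<in> parcs G" by blast
    then show "\<exists>p. awalk u p v \<and> length p = 2"
      by (intro exI[of _ "[(u, w), (w, v)]"]) (auto simp: awalk_simps dest: in_arcsD1 in_arcsD2)
  qed
  also have "(\<exists>p. awalk u p v \<and> length p < 2) \<longleftrightarrow> u = v \<or> (u, v) \<in> parcs G"
  proof
    assume "\<exists>p. awalk u p v \<and> length p < 2"
    then show "u = v \<or> (u, v) \<in> parcs G"
      by (auto simp: numeral_2_eq_2 less_Suc_eq length_Suc_conv awalk_simps)
  next
    assume "u = v \<or> (u, v) \<in> parcs G"
    then show "\<exists>p. awalk u p v \<and> length p < 2"
    proof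
      assume "u = v"
      with assms show ?thesis
        by (intro exI[of _ "[]"]) (simp add: awalk_simps)
    next
      assume "(u, v) \<in> parcs G"
      then show ?thesis
        by (intro exI[of _ "[(u, v)]"]) (auto simp: awalk_simps dest: in_arcsD1 in_arcsD2)
    qed
  qed
  finally show ?thesis by blast
qed

lemma awalk_proper_2_coloring_parity:
  assumes "\<forall>(x, y)\<in>parcs G. c x \<noteq> (c y :: bool)" and "awalk u p v"
  shows "c u = c v \<longleftrightarrow> even (length p)"
  using assms(2)
proof (induct p arbitrary: u)
  case Nil
  then show ?case by (simp add: awalk_simps)
next
  case (Cons e p)
  then have e: "e \<in> parcs G" "fst e = u" and p: "awalk (snd e) p v"
    by (auto simp: awalk_simps)
  from e have "c u \<noteq> c (snd e)"
    using assms(1) by (cases e) auto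
  with Cons(1)[OF p] show ?case by auto
qed

text \<open>In a bipartite graph, two distinct vertices of one part that are at distance at most \<open>3\<close> are
  joined by a walk of positive even length at most \<open>3\<close>, while vertices of different parts are never
  joined by a walk of length \<open>2\<close>.\<close>

lemma graph_dist_eq_2_iff_same_color:
  assumes c: "\<forall>(x, y)\<in>parcs G. c x \<noteq> (c y :: bool)"
    and u: "u \<in> pverts G" and le3: "graph_dist G u v \<le> 3"
  shows "graph_dist G u v = 2 \<longleftrightarrow> u \<noteq> v \<and> c u = c v"
proof
  assume "graph_dist G u v = 2"
  then obtain w where "u \<noteq> v" "(u, w) \<in> parcs G" "(w, v) \<in> parcs G"
    using graph_dist_eq_2_iff[OF u] by blast
  then show "u \<noteq> v \<and> c u = c v"
    using c by blast
next
  assume uv: "u \<noteq> v \<and> c u = c v"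
  obtain p where p: "awalk u p v" and len: "length p \<le> 3"
    using le3 graph_dist_le_iff[of u v 3] by auto
  have even: "even (length q)" if "awalk u q v" for q
    using awalk_proper_2_coloring_parity[OF c that] uv by simp
  have pos: "length q \<noteq> 0" if "awalk u q v" for q
    using that uv by (auto simp: awalk_simps)
  have ge2: "2 \<le> length q" if "awalk u q v" for q
    using even[OF that] pos[OF that] by presburger
  have "length p \<le> 2"
    using even[OF p] len by presburger
  then have "graph_dist G u v \<le> 2"
    using p graph_dist_le_iff[of u v 2] by auto
  moreover have "\<not> graph_dist G u v < 2"
    using ge2 graph_dist_less_iff[of u v 2] by fastforce
  ultimately show "graph_dist G u v = 2" by simp
qed

end

section \<open>Diameter and 2-colorings\<close>

lemma (in pair_graph) graph_diam_le_iff: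
  assumes "pverts G \<noteq> {}"
  shows "graph_diam G \<le> d \<longleftrightarrow> (\<forall>u\<in>pverts G. \<forall>v\<in>pverts G. graph_dist G u v \<le> d)"
proof -
  have "{graph_dist G u v | u v. u \<in> pverts G \<and> v \<in> pverts G}
      = (\<lambda>(u, v). graph_dist G u v) ` (pverts G \<times> pverts G)"
    by auto
  then show ?thesis
    unfolding graph_diam_def using assms pair_finite_verts by auto
qed

text \<open>This is the heart of the matter. Suppose that the pairs at distance \<open>2\<close> are those of equal
  color. Adjacent vertices are not at distance \<open>2\<close>, so the coloring is proper. For \<open>u\<close> and \<open>v\<close> of
  different colors, one of them, say \<open>u\<close>, has the color of \<open>a\<close> and \<open>b\<close> and hence another vertex at
  distance \<open>2\<close>; so \<open>u\<close> has a neighbour \<open>w\<close>. This \<open>w\<close> has the color of \<open>v\<close>, hence is equal to \<open>v\<close>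
  or at distance \<open>2\<close> from it, and \<open>u\<close> and \<open>v\<close> are at distance at most \<open>3\<close>. The converse is the parity
  argument above. The pair \<open>a\<close>, \<open>b\<close> also rules out a diameter below \<open>2\<close>.\<close>

lemma (in pair_graph) dist_2_iff_same_color_iff_bipartite_diam:
  fixes c :: "'a \<Rightarrow> bool"
  assumes a: "a \<in> pverts G" and b: "b \<in> pverts G" and ab: "a \<noteq> b" "c a = c b"
  shows "(\<forall>u\<in>pverts G. \<forall>v\<in>pverts G. graph_dist G u v = 2 \<longleftrightarrow> u \<noteq> v \<and> c u = c v) \<longleftrightarrow>
    (\<forall>(u, v)\<in>parcs G. c u \<noteq> c v) \<and> 2 \<le> graph_diam G \<and> graph_diam G \<le> 3"
    (is "?L \<longleftrightarrow> ?R")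
proof
  assume L: ?L
  have bip: "c u \<noteq> c v" if "(u, v) \<in> parcs G" for u v
  proof
    assume "c u = c v"
    moreover have "u \<in> pverts G" "v \<in> pverts G" "u \<noteq> v"
      using that in_arcsD1 in_arcsD2 no_loops' by auto
    ultimately have "graph_dist G u v = 2" using L by blast
    with that show False
      using graph_dist_eq_2_iff[OF \<open>u \<in> pverts G\<close>] by blast
  qed
  have same: "\<exists>w. (u, w) \<in> parcs G \<and> (w, v) \<in> parcs G"
    if "u \<in> pverts G" "v \<in> pverts G" "u \<noteq> v" "c u = c v" for u v
    using L that graph_dist_eq_2_iff by blast
  have cross: "\<exists>p. awalk u p v \<and> length p \<le> 3"
    if u: "u \<in> pverts G" and v: "v \<in> pverts G" and "c u \<noteq> c v" "c u = c a" for u v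
  proof -
    obtain u' where "u' \<in> pverts G" "u \<noteq> u'" "c u = c u'"
      using a b ab \<open>c u = c a\<close> by metis
    then obtain w where w: "(u, w) \<in> parcs G"
      using same u by blast
    then have "w \<in> pverts G" "c w = c v"
      using bip[OF w] \<open>c u \<noteq> c v\<close> in_arcsD2 by auto
    show ?thesis
    proof (cases "w = v")
      case True
      with w u v show ?thesis
        by (intro exI[of _ "[(u, v)]"]) (simp add: awalk_simps)
    next
      case False
      then obtain x where "(w, x) \<in> parcs G" "(x, v) \<in> parcs G"
        using same \<open>w \<in> pverts G\<close> v \<open>c w = c v\<close> by blast
      with w u v show ?thesis
        by (intro exI[of _ "[(u, w), (w, x), (x, v)]"])
          (auto simp: awalk_simps dest: in_arcsD1 in_arcsD2)
    qed
  qed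
  have "graph_dist G u v \<le> 3" if u: "u \<in> pverts G" and v: "v \<in> pverts G" for u v
  proof -
    have "\<exists>p. awalk u p v \<and> length p \<le> 3"
    proof (cases "c u = c v")
      case True
      show ?thesis
      proof (cases "u = v")
        case True
        with u show ?thesis by (intro exI[of _ "[]"]) (simp add: awalk_simps)
      next
        case False
        then have "graph_dist G u v \<le> 3" using L u v True by fastforce
        then show ?thesis using graph_dist_le_iff[of u v 3] by simp
      qed
    next
      case False
      show ?thesis
      proof (cases "c u = c a")
        case True
        with cross u v False show ?thesis by blast
      next
        case False
        with \<open>c u \<noteq> c v\<close> have "c v = c a" by blast
        with cross[of v u] u v \<open>c u \<noteq> c v\<close> obtain p where "awalk v p u" "length p \<le> 3"
          by metis
        moreover have "length (rev_path p) = length p" by (induct p) auto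
        ultimately show ?thesis
          by (intro exI[of _ "rev_path p"]) simp
      qed
    qed
    then show ?thesis using graph_dist_le_iff[of u v 3] by simp
  qed
  then have "graph_diam G \<le> 3"
    using a graph_diam_le_iff by blast
  moreover have "graph_dist G a b = 2" using L a b ab by blast
  then have "2 \<le> graph_diam G"
    using graph_diam_le_iff[of "graph_diam G"] a b by fastforce
  ultimately show ?R using bip by auto
next
  assume R: ?R
  show ?L
  proof (intro ballI)
    fix u v assume "u \<in> pverts G" "v \<in> pverts G"
    moreover from this have "graph_dist G u v \<le> 3"
      using graph_diam_le_iff[of 3] R by blast
    ultimately show "graph_dist G u v = 2 \<longleftrightarrow> u \<noteq> v \<and> c u = c v"
      using graph_dist_eq_2_iff_same_color R by blast
  qed
qed

section \<open>Isomorphisms onto the model graphs\<close>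

text \<open>For the model graphs on \<open>{..<m} <+> {..<n}\<close> the color of a vertex is \<open>isl\<close>.\<close>

lemma in_parcs_disjoint_union_complete_graph_iff:
  "(x, y) \<in> parcs (disjoint_union (complete_graph m) (complete_graph n)) \<longleftrightarrow>
    x \<in> {..<m} <+> {..<n} \<and> y \<in> {..<m} <+> {..<n} \<and> x \<noteq> y \<and> isl x = isl y"
  by (cases x; cases y) (auto simp: disjoint_union_def complete_graph_def)

lemma in_parcs_complete_bipartite_graph_iff:
  "(x, y) \<in> parcs (complete_bipartite_graph m n) \<longleftrightarrow>
    x \<in> {..<m} <+> {..<n} \<and> y \<in> {..<m} <+> {..<n} \<and> isl x \<noteq> isl y"
  by (cases x; cases y) (auto simp: complete_bipartite_graph_def)

lemma pverts_disjoint_union_complete_graph: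
  "pverts (disjoint_union (complete_graph m) (complete_graph n)) = {..<m} <+> {..<n}"
  by (simp add: disjoint_union_def complete_graph_def)

lemma pair_wf_digraph_models:
  "pair_wf_digraph (disjoint_union (complete_graph m) (complete_graph n))"
  "pair_wf_digraph (complete_bipartite_graph m n)"
  "pair_wf_digraph (complement_graph (complete_bipartite_graph m n))"
  "pair_wf_digraph (two_distance_graph X)"
  by unfold_locales
    (auto simp: disjoint_union_def complete_graph_def complete_bipartite_graph_def
      complement_graph_def two_distance_graph_def)

lemma two_distance_graph_iso_disjoint_union_iff:
  "digraph_iso (with_proj (two_distance_graph X))
      (with_proj (disjoint_union (complete_graph m) (complete_graph n))) \<longleftrightarrow>
    (\<exists>f. bij_betw f (pverts X) ({..<m} <+> {..<n}) \<and>
      (\<forall>u\<in>pverts X. \<forall>v\<in>pverts X.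
        graph_dist X u v = 2 \<longleftrightarrow> u \<noteq> v \<and> isl (f u) = isl (f v)))"
proof -
  have T: "pverts (two_distance_graph X) = pverts X"
    "(u, v) \<in> parcs (two_distance_graph X) \<longleftrightarrow>
      u \<in> pverts X \<and> v \<in> pverts X \<and> graph_dist X u v = 2" for u v
    by (auto simp: two_distance_graph_def)
  have "(f u, f v) \<in> parcs (disjoint_union (complete_graph m) (complete_graph n)) \<longleftrightarrow>
      u \<noteq> v \<and> isl (f u) = isl (f v)"
    if "bij_betw f (pverts X) ({..<m} <+> {..<n})" "u \<in> pverts X" "v \<in> pverts X" for f u v
    using that bij_betwE[OF that(1)] bij_betw_imp_inj_on[OF that(1)]
    by (auto simp: in_parcs_disjoint_union_complete_graph_iff dest: inj_onD)
  then show ?thesis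
    unfolding digraph_iso_with_proj_iff[OF pair_wf_digraph_models(4,1)] T
      pverts_disjoint_union_complete_graph
    by (intro ex_cong1 conj_cong refl ball_cong) auto
qed

text \<open>The bijection here and the one in the preceding lemma range over the same set, which lets the
  two descriptions be compared for one fixed \<open>f\<close>.\<close>

lemma iso_to_spanning_subgraph_complete_bipartite_iff:
  assumes "pair_wf_digraph X"
  shows "(\<exists>Y. spanning (with_proj Y) (with_proj (complete_bipartite_graph m n)) \<and>
      digraph_iso (with_proj X) (with_proj Y)) \<longleftrightarrow>
    (\<exists>f. bij_betw f (pverts X) ({..<m} <+> {..<n}) \<and>
      (\<forall>(u, v)\<in>parcs X. isl (f u) \<noteq> isl (f v)))"
proof -
  interpret pair_wf_digraph X by (fact assms)
  have "pverts (complete_bipartite_graph m n) = {..<m} <+> {..<n}"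
    by (simp add: complete_bipartite_graph_def)
  moreover have "(f u, f v) \<in> parcs (complete_bipartite_graph m n) \<longleftrightarrow> isl (f u) \<noteq> isl (f v)"
    if "bij_betw f (pverts X) ({..<m} <+> {..<n})" "(u, v) \<in> parcs X" for f u v
    using that bij_betwE[OF that(1)] in_arcsD1 in_arcsD2
    by (auto simp: in_parcs_complete_bipartite_graph_iff)
  ultimately show ?thesis
    unfolding iso_to_spanning_subgraph_iff[OF assms pair_wf_digraph_models(2)]
    by (intro ex_cong1 conj_cong ball_cong) auto
qed

lemma obtain_two_vertices_of_one_color:
  fixes f :: "'a \<Rightarrow> nat + nat"
  assumes f: "bij_betw f V ({..<m} <+> {..<n})" and "m > 1 \<or> n > 1"
  obtains a b where "a \<in> V" "b \<in> V" "a \<noteq> b" "isl (f a) = isl (f b)"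
proof -
  obtain x y where xy: "x \<in> {..<m} <+> {..<n}" "y \<in> {..<m} <+> {..<n}" "x \<noteq> y" "isl x = isl y"
  proof (cases "m > 1")
    case True
    then show ?thesis by (intro that[of "Inl 0" "Inl 1"]) auto
  next
    case False
    with assms(2) show ?thesis by (intro that[of "Inr 0" "Inr 1"]) auto
  qed
  obtain a b where "a \<in> V" "b \<in> V" "x = f a" "y = f b"
    using f xy(1,2) unfolding bij_betw_def by blast
  with xy(3,4) show thesis by (intro that[of a b]) auto
qed

section \<open>The two equivalences\<close>

lemma two_distance_graph_eq_disjoint_union_iff:
  assumes "m > 1 \<or> n > 1" and "pair_graph X"
  shows "digraph_iso (with_proj (two_distance_graph X))
      (with_proj (disjoint_union (complete_graph m) (complete_graph n))) \<longleftrightarrow>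
    (\<exists>Y. spanning (with_proj Y) (with_proj (complete_bipartite_graph m n)) \<and>
      digraph_iso (with_proj X) (with_proj Y)) \<and>
    2 \<le> graph_diam X \<and> graph_diam X \<le> 3"
proof -
  interpret pair_graph X by (fact assms(2))
  have "(\<forall>u\<in>pverts X. \<forall>v\<in>pverts X.
        graph_dist X u v = 2 \<longleftrightarrow> u \<noteq> v \<and> isl (f u) = isl (f v)) \<longleftrightarrow>
      (\<forall>(u, v)\<in>parcs X. isl (f u) \<noteq> isl (f v)) \<and> 2 \<le> graph_diam X \<and> graph_diam X \<le> 3"
    if f: "bij_betw f (pverts X) ({..<m} <+> {..<n})" for f
  proof -
    obtain a b where "a \<in> pverts X" "b \<in> pverts X" "a \<noteq> b" "isl (f a) = isl (f b)"
      using f assms(1) by (rule obtain_two_vertices_of_one_color)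
    then show ?thesis
      by (rule dist_2_iff_same_color_iff_bipartite_diam)
  qed
  then show ?thesis
    unfolding two_distance_graph_iso_disjoint_union_iff
      iso_to_spanning_subgraph_complete_bipartite_iff[OF pair_wf_digraph_axioms]
    by blast
qed

text \<open>On two vertices no distance is \<open>2\<close>, and the vertices are either adjacent or not; so each side
  says that \<open>X\<close> has two vertices.\<close>

lemma two_distance_graph_eq_two_isolated_vertices_iff:
  assumes "pair_graph X"
  shows "digraph_iso (with_proj (two_distance_graph X))
      (with_proj (disjoint_union (complete_graph 1) (complete_graph 1))) \<longleftrightarrow>
    digraph_iso (with_proj X) (with_proj (complete_bipartite_graph 1 1)) \<or>
    digraph_iso (with_proj X) (with_proj (complement_graph (complete_bipartite_graph 1 1)))"
    (is "?L \<longleftrightarrow> ?R1 \<or> ?R2")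
proof -
  interpret pair_graph X by (fact assms)
  let ?K = "complete_bipartite_graph 1 1"
  let ?bij = "\<lambda>f :: 'a \<Rightarrow> nat + nat. bij_betw f (pverts X) ({..<1} <+> {..<1})"
  have V: "pverts ?K = {..<1} <+> {..<1}" "pverts (complement_graph ?K) = {..<1} <+> {..<1}"
    by (simp_all add: complete_bipartite_graph_def complement_graph_def)
  have same: "x = y" if "x \<in> {..<1} <+> {..<1}" "y \<in> {..<1} <+> {..<1}" "isl x = isl y"
    for x y :: "nat + nat"
    using that by auto
  have inj: "u = v" if "?bij f" "u \<in> pverts X" "v \<in> pverts X" "isl (f u) = isl (f v)" for f u v
    using same[of "f u" "f v"] that bij_betwE[OF that(1)] bij_betw_imp_inj_on[OF that(1)]
    by (auto dest: inj_onD)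
  have L: "?L \<longleftrightarrow> (\<exists>f. ?bij f)"
  proof -
    have "graph_dist X u v = 2 \<longleftrightarrow> u \<noteq> v \<and> isl (f u) = isl (f v)"
      if f: "?bij f" and u: "u \<in> pverts X" and v: "v \<in> pverts X" for f u v
    proof -
      have "graph_dist X u v \<noteq> 2"
      proof
        assume "graph_dist X u v = 2"
        then obtain w where "u \<noteq> v" and w: "(u, w) \<in> parcs X" "(w, v) \<in> parcs X"
          using graph_dist_eq_2_iff[OF u] by blast
        have "u \<noteq> w" "w \<noteq> v" "w \<in> pverts X"
          using w no_loops' in_arcsD2 by auto
        \<comment> \<open>The two colors cannot tell three vertices apart.\<close>
        then show False
          using inj[OF f] u v \<open>u \<noteq> v\<close> by metis
      qed
      with inj[OF f u v] show ?thesis by blast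
    qed
    then show ?thesis
      unfolding two_distance_graph_iso_disjoint_union_iff by blast
  qed
  have K: "(f u, f v) \<in> parcs ?K \<longleftrightarrow> u \<noteq> v"
    and Kc: "(f u, f v) \<notin> parcs (complement_graph ?K)"
    if f: "?bij f" and u: "u \<in> pverts X" and v: "v \<in> pverts X" for f u v
  proof -
    have fuv: "f u \<in> {..<1} <+> {..<1}" "f v \<in> {..<1} <+> {..<1}"
      using bij_betwE[OF f] u v by auto
    then show "(f u, f v) \<in> parcs ?K \<longleftrightarrow> u \<noteq> v"
      using inj[OF f u v] unfolding in_parcs_complete_bipartite_graph_iff by auto
    show "(f u, f v) \<notin> parcs (complement_graph ?K)"
      using fuv same[OF fuv] in_parcs_complete_bipartite_graph_iff[of "f u" "f v" 1 1]
      by (auto simp: complement_graph_def)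
  qed
  note iso = digraph_iso_with_proj_iff[OF pair_wf_digraph_axioms pair_wf_digraph_models(2)]
    digraph_iso_with_proj_iff[OF pair_wf_digraph_axioms pair_wf_digraph_models(3)]
  show ?thesis
  proof
    assume ?L
    then obtain f where f: "?bij f" using L by blast
    show "?R1 \<or> ?R2"
    proof (cases "parcs X = {}")
      case True
      then have ?R2
        unfolding iso V using f Kc[OF f] by blast
      then show ?thesis ..
    next
      case False
      then obtain a b where ab: "(a, b) \<in> parcs X" by auto
      have "(u, v) \<in> parcs X \<longleftrightarrow> (f u, f v) \<in> parcs ?K"
        if u: "u \<in> pverts X" and v: "v \<in> pverts X" for u v
      proof -
        have "(u, v) \<in> parcs X" if "u \<noteq> v"
        proof -
          have "a \<in> pverts X" "b \<in> pverts X" "a \<noteq> b"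
            using ab in_arcsD1 in_arcsD2 no_loops' by auto
          then have "u = a \<and> v = b \<or> u = b \<and> v = a"
            using inj[OF f] u v \<open>u \<noteq> v\<close> by metis
          then show ?thesis
            using ab arcs_symmetric by auto
        qed
        then show ?thesis
          using K[OF f u v] no_loops' by blast
      qed
      then have ?R1
        unfolding iso V using f by blast
      then show ?thesis ..
    qed
  next
    assume "?R1 \<or> ?R2"
    then show ?L
      unfolding L iso V by blast
  qed
qed

theorem theorem4p4:
  fixes m n :: nat and X :: "'a pair_pre_digraph"
  assumes "m > 0" and "n > 0" and "pair_graph X"
  shows
    "(digraph_iso (with_proj (two_distance_graph X))
          (with_proj (disjoint_union (complete_graph 1) (complete_graph 1)))
        \<longleftrightarrow> digraph_iso (with_proj X) (with_proj (complete_bipartite_graph 1 1))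
          \<or> digraph_iso (with_proj X) (with_proj (complement_graph (complete_bipartite_graph 1 1))))
     \<and> (m > 1 \<or> n > 1 \<longrightarrow>
        (digraph_iso (with_proj (two_distance_graph X))
            (with_proj (disjoint_union (complete_graph m) (complete_graph n)))
          \<longleftrightarrow> (\<exists>Y. spanning (with_proj Y) (with_proj (complete_bipartite_graph m n))
                \<and> digraph_iso (with_proj X) (with_proj Y))
              \<and> 2 \<le> graph_diam X \<and> graph_diam X \<le> 3))"
  using two_distance_graph_eq_two_isolated_vertices_iff[OF assms(3)]
    two_distance_graph_eq_disjoint_union_iff[OF _ assms(3)]
  by blast

end
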